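(* The two automorphisms $\sigma:(A,B,C)\mapsto(B,A,\tilde C)$ and $\tau:(A,B,C)\mapsto(\tilde B,\tilde C,A)$ of $\mathrm{Spin}_8$ generate a group $\hat\Gamma\subset\mathrm{Aut}(\mathrm{Spin}_8)$ which is isomorphic to the symmetric group $S_3$.
   Context: $\mathbb{O}\cong\mathbb{R}^8$ denotes the octonions, and $\kappa=\mathrm{diag}(1,-1,\dots,-1)$ is the matrix of octonionic conjugation $x\mapsto\overline x$. For $D\in SO_8$ put $\tilde D=\kappa D\kappa\in SO_8$. $\mathrm{Spin}_8$ is realized as the group of triples $(A,B,C)\in(SO_8)^3$ satisfying $B(x\cdot y)=(Cx)\cdot(Ay)$ for all $x,y\in\mathbb{O}$. *)

theory Defs
  imports "HOL-Analysis.Analysis" "HOL-Algebra.Bij" "HOL-Algebra.Sym_Groups"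
begin

text \<open>
  Coordinates of \<^typ>\<open>real^4\<close> and \<^typ>\<open>real^8\<close> are numbered from \<open>1\<close>, as in \<^const>\<open>vector\<close>, and
  coordinate \<open>1\<close> is the real part. (In the index type \<open>8\<close> the last index \<open>8\<close> equals \<open>0\<close>.)
\<close>

definition quat_mult :: "real^4 \<Rightarrow> real^4 \<Rightarrow> real^4" where
  "quat_mult p q = vector
     [p$1 * q$1 - p$2 * q$2 - p$3 * q$3 - p$4 * q$4,
      p$1 * q$2 + p$2 * q$1 + p$3 * q$4 - p$4 * q$3,
      p$1 * q$3 - p$2 * q$4 + p$3 * q$1 + p$4 * q$2,
      p$1 * q$4 + p$2 * q$3 - p$3 * q$2 + p$4 * q$1]"

definition quat_cnj :: "real^4 \<Rightarrow> real^4" where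
  "quat_cnj p = vector [p$1, - p$2, - p$3, - p$4]"

definition oct_pair :: "real^4 \<Rightarrow> real^4 \<Rightarrow> real^8" where
  "oct_pair a b = vector [a$1, a$2, a$3, a$4, b$1, b$2, b$3, b$4]"

definition oct_fst :: "real^8 \<Rightarrow> real^4" where
  "oct_fst x = vector [x$1, x$2, x$3, x$4]"

definition oct_snd :: "real^8 \<Rightarrow> real^4" where
  "oct_snd x = vector [x$5, x$6, x$7, x$8]"

text \<open>
  The octonions are the Cayley--Dickson double of the quaternions:
  \<open>(a, b) (c, d) = (a c - d* b, d a + b c*)\<close>, with conjugation \<open>(a, b)* = (a*, - b)\<close>.
\<close>

definition oct_mult :: "real^8 \<Rightarrow> real^8 \<Rightarrow> real^8"  (infixl "\<odot>" 70) where
  "x \<odot> y =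
     oct_pair
       (quat_mult (oct_fst x) (oct_fst y) - quat_mult (quat_cnj (oct_snd y)) (oct_snd x))
       (quat_mult (oct_snd y) (oct_fst x) + quat_mult (oct_snd x) (quat_cnj (oct_fst y)))"

definition oct_cnj :: "real^8 \<Rightarrow> real^8" where
  "oct_cnj x = oct_pair (quat_cnj (oct_fst x)) (- oct_snd x)"

definition kappa :: "real^8^8" where
  "kappa = (\<chi> i j. if i = j then (if i = 1 then 1 else - 1) else 0)"

definition tilde :: "real^8^8 \<Rightarrow> real^8^8" where
  "tilde D = kappa ** D ** kappa"

type_synonym triple = "(real^8^8) \<times> (real^8^8) \<times> (real^8^8)"

definition Spin8 :: "triple monoid" where
  "Spin8 =
     \<lparr>carrier = {(A, B, C). rotation_matrix A \<and> rotation_matrix B \<and> rotation_matrix C \<and>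
                 (\<forall>x y. B *v (x \<odot> y) = (C *v x) \<odot> (A *v y))},
      monoid.mult = (\<lambda>(A, B, C) (A', B', C'). (A ** A', B ** B', C ** C')),
      one = (mat 1, mat 1, mat 1)\<rparr>"

text \<open>
  Elements of \<^term>\<open>auto G\<close> are extensional functions, hence the restrictions to the carrier.
\<close>

definition spin_sigma :: "triple \<Rightarrow> triple" where
  "spin_sigma = restrict (\<lambda>(A, B, C). (B, A, tilde C)) (carrier Spin8)"

definition spin_tau :: "triple \<Rightarrow> triple" where
  "spin_tau = restrict (\<lambda>(A, B, C). (tilde B, tilde C, A)) (carrier Spin8)"

definition Gamma_hat :: "(triple \<Rightarrow> triple) set" where
  "Gamma_hat = generate (AutoGroup Spin8) {spin_sigma, spin_tau}"

text \<open>
  \<^const>\<open>kappa\<close> is the matrix of conjugation, and \<open>\<odot>\<close> is a unital multiplication for which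
  the Euclidean norm is multiplicative; by Hurwitz, \<open>\<odot>\<close> is therefore the octonion product.
\<close>

lemma exhaust_8: "(i::8) = 1 \<or> i = 2 \<or> i = 3 \<or> i = 4 \<or> i = 5 \<or> i = 6 \<or> i = 7 \<or> i = 8"
proof (induct i)
  case (of_int z)
  then have "z = 0 \<or> z = 1 \<or> z = 2 \<or> z = 3 \<or> z = 4 \<or> z = 5 \<or> z = 6 \<or> z = 7"
    by fastforce
  then show ?case by auto
qed

lemma forall_8: "(\<forall>i::8. P i) \<longleftrightarrow> P 1 \<and> P 2 \<and> P 3 \<and> P 4 \<and> P 5 \<and> P 6 \<and> P 7 \<and> P 8"
  by (metis exhaust_8)

lemma UNIV_8: "UNIV = {1, 2, 3, 4, 5, 6, 7, 8::8}"
  using exhaust_8 by blast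

lemma sum_8: "sum f (UNIV::8 set) = f 1 + f 2 + f 3 + f 4 + f 5 + f 6 + f 7 + f 8"
  unfolding UNIV_8 by (simp add: ac_simps)

lemma vector_4_nth [simp]:
  "(vector [a, b, c, d] :: real^4) $ 1 = a"
  "(vector [a, b, c, d] :: real^4) $ 2 = b"
  "(vector [a, b, c, d] :: real^4) $ 3 = c"
  "(vector [a, b, c, d] :: real^4) $ 4 = d"
  "(vector [a, b, c, d] :: real^4) $ 0 = d"
  by (simp_all add: vector_def)

lemma vector_8_nth [simp]:
  "(vector [a, b, c, d, e, f, g, h] :: real^8) $ 1 = a"
  "(vector [a, b, c, d, e, f, g, h] :: real^8) $ 2 = b"
  "(vector [a, b, c, d, e, f, g, h] :: real^8) $ 3 = c"
  "(vector [a, b, c, d, e, f, g, h] :: real^8) $ 4 = d"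
  "(vector [a, b, c, d, e, f, g, h] :: real^8) $ 5 = e"
  "(vector [a, b, c, d, e, f, g, h] :: real^8) $ 6 = f"
  "(vector [a, b, c, d, e, f, g, h] :: real^8) $ 7 = g"
  "(vector [a, b, c, d, e, f, g, h] :: real^8) $ 8 = h"
  "(vector [a, b, c, d, e, f, g, h] :: real^8) $ 0 = h"
  by (simp_all add: vector_def)

lemmas oct_unfold =
  oct_mult_def oct_cnj_def oct_pair_def oct_fst_def oct_snd_def quat_mult_def quat_cnj_def

lemma kappa_eq_cnj: "kappa *v x = oct_cnj x"
  by (simp add: vec_eq_iff forall_8 matrix_vector_mult_def kappa_def sum_8 oct_unfold)

lemma oct_mult_one: "axis 1 1 \<odot> x = x" "x \<odot> axis 1 1 = x"
  by (simp_all add: vec_eq_iff forall_8 oct_unfold axis_def)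

lemma norm_oct_mult: "norm (x \<odot> y) = norm x * norm y"
proof -
  have "(x \<odot> y) \<bullet> (x \<odot> y) = (x \<bullet> x) * (y \<bullet> y)"
    by (simp add: inner_vec_def sum_8 oct_unfold) algebra
  then show ?thesis
    by (simp add: norm_eq_sqrt_inner real_sqrt_mult)
qed

end

theory Submission
  imports Defs
begin

text \<open>
  The defining equation of \<open>Spin8\<close> looks asymmetric in \<open>A\<close>, \<open>B\<close>, \<open>C\<close>, but it is the invariance
  of a trilinear form with a threefold symmetry. Put \<open>t(x, y, z) = \<langle>x y, z*\<rangle>\<close>, the real part of
  \<open>(x y) z\<close>. For orthogonal \<open>B\<close>, pairing \<open>B (x y) = (C x) (A y)\<close> with \<open>B z*\<close> shows that it
  is equivalent to \<open>t(C x, A y, tilde B z) = t(x, y, z)\<close> for all \<open>x, y, z\<close>. So \<open>Spin8\<close> consists of the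
  triples of rotations, read as \<open>X = (C, A, tilde B)\<close>, that preserve \<open>t\<close>
  (lemma \<open>mem_Spin8_iff\<close>).

  The form \<open>t\<close> is invariant under cyclic permutation of its arguments, and under a transposition
  of two arguments provided that all three are conjugated (lemma \<open>octform_swap\<close>). Hence the
  symmetric group on the three slots acts on \<open>Spin8\<close>: a permutation moves the entries of \<open>X\<close> and, if it is
  odd, also applies \<open>tilde\<close> to each of them. This is the homomorphism \<open>triality\<close> from
  \<open>sym_group 3\<close> to the automorphism group. In slots, \<open>\<sigma>\<close> sends \<open>(C, A, tilde B)\<close> to
  \<open>(tilde C, B, tilde A)\<close>, which is the action of the transposition of slots 2 and 3, while
  \<open>\<tau>\<close> is the cyclic shift. These two permutations generate the symmetric group, so the image of
  \<open>triality\<close> is exactly \<open>Gamma_hat\<close>.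

  It remains to see that the action is faithful. The three nontrivial sign triples
  \<open>(1, -1, -1)\<close>, \<open>(-1, 1, -1)\<close>, \<open>(-1, -1, 1)\<close> belong to \<open>Spin8\<close>, since \<open>t\<close> is unchanged when two of
  its arguments change sign, and \<open>tilde\<close> fixes them entry by entry. So \<open>triality p\<close> permutes
  them exactly as \<open>p\<close> permutes the slots (lemma \<open>triality_sign_triple\<close>), and \<open>p\<close> can be read off.
\<close>

(* Keeps the slot number 1 in this form, as in the definitions. *)
declare One_nat_def [simp del]

abbreviation transposition :: "nat \<Rightarrow> nat \<Rightarrow> nat \<Rightarrow> nat" where
  "transposition \<equiv> Transposition.transpose"

section \<open>Conjugation of rotations by \<open>kappa\<close>\<close>

lemma oct_cnj_cnj [simp]: "oct_cnj (oct_cnj x) = x"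
  by (simp add: vec_eq_iff forall_8 oct_unfold)

lemma kappa_kappa: "kappa ** kappa = mat 1"
  by (simp add: matrix_eq kappa_eq_cnj flip: matrix_vector_mul_assoc)

lemma tilde_apply: "tilde D *v x = oct_cnj (D *v oct_cnj x)"
  by (simp add: tilde_def kappa_eq_cnj flip: matrix_vector_mul_assoc)

lemma tilde_tilde [simp]: "tilde (tilde D) = D"
  by (simp add: matrix_eq tilde_apply)

lemma tilde_mult: "tilde (D ** E) = tilde D ** tilde E"
  by (simp add: matrix_eq tilde_apply flip: matrix_vector_mul_assoc)

lemma tilde_one [simp]: "tilde (mat 1) = mat 1"
  by (simp add: matrix_eq tilde_apply)

lemma tilde_minus: "tilde (- D) = - tilde D"
  by (simp add: vec_eq_iff tilde_def matrix_matrix_mult_def sum_negf)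

lemma orthogonal_kappa: "orthogonal_matrix kappa"
proof -
  have "transpose kappa = kappa"
    by (simp add: vec_eq_iff Finite_Cartesian_Product.transpose_def kappa_def)
  then show ?thesis
    by (simp add: orthogonal_matrix_def kappa_kappa)
qed

lemma rotation_tilde: "rotation_matrix D \<Longrightarrow> rotation_matrix (tilde D)"
proof -
  assume "rotation_matrix D"
  moreover have "det kappa * det kappa = 1"
    by (metis det_mul det_I kappa_kappa)
  ultimately show ?thesis
    by (simp add: rotation_matrix_def tilde_def orthogonal_matrix_mul orthogonal_kappa det_mul
        mult.commute)
qed

lemma rotation_tilde_iff [simp]: "rotation_matrix (tilde D) \<longleftrightarrow> rotation_matrix D"
  by (metis rotation_tilde tilde_tilde)

lemma minus_one_apply: "(- mat 1 :: real^'n^'n) *v v = - v"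
proof -
  have "(- A :: real^'n^'n) *v v = - (A *v v)" for A
    by (simp add: vec_eq_iff matrix_vector_mult_def sum_negf)
  then show ?thesis
    by simp
qed

lemma rotation_minus_one: "rotation_matrix (- mat 1 :: real^8^8)"
proof -
  have "(- mat 1 :: real^8^8) = matrix ((*\<^sub>R) (-1))"
    by (simp add: matrix_def vec_eq_iff mat_def axis_def)
  then have "det (- mat 1 :: real^8^8) = (-1) ^ CARD(8)"
    by (metis det_matrix_scaleR)
  moreover have "transpose (- mat 1 :: real^8^8) = - mat 1"
    by (simp add: vec_eq_iff Finite_Cartesian_Product.transpose_def mat_def)
  moreover have "(- mat 1 :: real^8^8) ** - mat 1 = mat 1"
    by (simp add: matrix_eq minus_one_apply flip: matrix_vector_mul_assoc)
  ultimately show ?thesis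
    by (simp add: rotation_matrix_def orthogonal_matrix_def)
qed

lemma orthogonal_inner:
  fixes Q :: "real^'n^'n"
  assumes "orthogonal_matrix Q"
  shows "(Q *v v) \<bullet> (Q *v w) = v \<bullet> w"
  using assms orthogonal_transformation_matrix[of "(*v) Q"]
  by (simp add: orthogonal_transformation_def)

section \<open>The trilinear form and its symmetries\<close>

text \<open>
  The three arguments form a family indexed by \<open>{1..3}\<close>, on which the permutations in
  \<open>sym_group 3\<close> act by composition.
\<close>

definition octform :: "(nat \<Rightarrow> real^8) \<Rightarrow> real" where
  "octform x = (x 1 \<odot> x 2) \<bullet> oct_cnj (x 3)"

lemma atLeastAtMost_1_3: "{1..3} = {1, 2, 3::nat}"
  by auto

lemma octform_cong: "(\<And>i. i \<in> {1..3} \<Longrightarrow> x i = y i) \<Longrightarrow> octform x = octform y"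
  by (simp add: octform_def)

text \<open>
  Conjugation reverses products, and the real part of \<open>(u v) w\<close> is invariant under conjugation and
  under cyclic shifts. A transposition is a reversal followed by a (possibly trivial) cyclic shift.
  Each of the three cases is an identity between polynomials in 24 coordinates.
\<close>

lemma octform_swap:
  assumes "a \<in> {1..3}" "b \<in> {1..3}" "a \<noteq> b"
  shows "octform (\<lambda>i. oct_cnj (x (transposition a b i))) = octform x"
proof -
  have "(oct_cnj v \<odot> oct_cnj u) \<bullet> w = (u \<odot> v) \<bullet> oct_cnj w"
       "(oct_cnj w \<odot> oct_cnj v) \<bullet> u = (u \<odot> v) \<bullet> oct_cnj w"
       "(oct_cnj u \<odot> oct_cnj w) \<bullet> v = (u \<odot> v) \<bullet> oct_cnj w" for u v w
    by (simp_all add: inner_vec_def sum_8 oct_unfold algebra_simps)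
  with assms show ?thesis
    by (auto simp: atLeastAtMost_1_3 octform_def Transposition.transpose_def)
qed

text \<open>
  The conjugations of two successive transpositions cancel, so only the sign of the permutation
  decides whether the arguments end up conjugated.
\<close>

lemma octform_permute:
  assumes "p permutes {1..3}"
  shows "octform (\<lambda>i. if evenperm p then x (p i) else oct_cnj (x (p i))) = octform x"
  using assms finite_atLeastAtMost
proof (induction arbitrary: x rule: permutes_induct)
  case id
  then show ?case by simp
next
  case (swap a b p)
  have "evenperm (transposition a b \<circ> p) \<longleftrightarrow> \<not> evenperm p"
    using swap by (simp add: evenperm_comp permutation_swap_id evenperm_swap
        permutes_imp_permutation[of "{1..3}"])
  then have "octform (\<lambda>i. if evenperm (transposition a b \<circ> p) then x ((transposition a b \<circ> p) i)
               else oct_cnj (x ((transposition a b \<circ> p) i)))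
    = octform (\<lambda>i. if evenperm p then oct_cnj (x (transposition a b (p i)))
               else oct_cnj (oct_cnj (x (transposition a b (p i)))))"
    by (auto intro: arg_cong[of _ _ octform])
  also have "\<dots> = octform (\<lambda>i. oct_cnj (x (transposition a b i)))"
    by (rule swap.IH)
  also have "\<dots> = octform x"
    using swap by (intro octform_swap)
  finally show ?case .
qed

section \<open>The group of triples preserving the form\<close>

text \<open>
  The order of the slots is the one in which \<open>C\<close>, \<open>A\<close> and \<open>tilde B\<close> act on the arguments of
  \<^const>\<open>octform\<close>. The conjugation of the third argument there is what turns \<open>B\<close> into \<open>tilde B\<close>.
\<close>

definition slot :: "triple \<Rightarrow> nat \<Rightarrow> real^8^8" where
  "slot = (\<lambda>(A, B, C) i. if i = 1 then C else if i = 2 then A else tilde B)"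

definition of_slots :: "(nat \<Rightarrow> real^8^8) \<Rightarrow> triple" where
  "of_slots X = (X 2, tilde (X 3), X 1)"

text \<open>
  The product rule \<open>B (x y) = (C x) (A y)\<close> can be tested by inner products with all \<open>z = B w\<close>, since
  \<open>B\<close> is surjective. On the left this gives \<open>\<langle>x y, w\<rangle>\<close>, because \<open>B\<close> is orthogonal, so the rule
  becomes invariance of the form with third argument \<open>w*\<close>.
\<close>

lemma mem_Spin8_iff:
  "T \<in> carrier Spin8 \<longleftrightarrow> (\<forall>i\<in>{1..3}. rotation_matrix (slot T i)) \<and>
     (\<forall>x. octform (\<lambda>i. slot T i *v x i) = octform x)"
proof -
  obtain A B C where T: "T = (A, B, C)"
    by (cases T)
  have "(\<forall>x y. B *v (x \<odot> y) = (C *v x) \<odot> (A *v y)) \<longleftrightarrow>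
    (\<forall>x. octform (\<lambda>i. slot T i *v x i) = octform x)" (is "?L \<longleftrightarrow> ?R")
    if B: "orthogonal_matrix B"
  proof
    assume ?L
    then show ?R
      by (simp add: T octform_def slot_def tilde_apply orthogonal_inner B flip: \<open>?L\<close>)
  next
    assume R: ?R
    show ?L
    proof (intro allI)
      fix x y
      have "((C *v x) \<odot> (A *v y)) \<bullet> z = (B *v (x \<odot> y)) \<bullet> z" for z
      proof -
        define w where "w = transpose B *v z"
        have Bz: "B *v w = z"
          unfolding w_def using B
          by (metis matrix_vector_mul_assoc matrix_vector_mul_lid orthogonal_matrix_def)
        define f where "f = (\<lambda>i::nat. if i = 1 then x else if i = 2 then y
          else oct_cnj w)"
        have "((C *v x) \<odot> (A *v y)) \<bullet> z = octform (\<lambda>i. slot T i *v f i)"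
          by (simp add: T octform_def slot_def f_def tilde_apply Bz)
        also have "\<dots> = (x \<odot> y) \<bullet> w"
          using R[rule_format, of f] by (simp add: octform_def f_def)
        also have "\<dots> = (B *v (x \<odot> y)) \<bullet> z"
          using orthogonal_inner[OF B, of "x \<odot> y" w] by (simp add: Bz)
        finally show ?thesis .
      qed
      then show "B *v (x \<odot> y) = (C *v x) \<odot> (A *v y)"
        by (metis vector_eq_rdot)
    qed
  qed
  then show ?thesis
    by (auto simp: T Spin8_def slot_def atLeastAtMost_1_3 rotation_matrix_def[of B])
qed

lemma slot_of_slots: "i \<in> {1..3} \<Longrightarrow> slot (of_slots X) i = X i"
  by (auto simp: slot_def of_slots_def atLeastAtMost_1_3)

lemma tilde_eq_iff [simp]: "tilde D = tilde E \<longleftrightarrow> D = E"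
  by (metis tilde_tilde)

lemma triple_eq_iff_slots: "S = T \<longleftrightarrow> (\<forall>i\<in>{1..3}. slot S i = slot T i)"
  by (cases S; cases T) (auto simp: slot_def atLeastAtMost_1_3)

lemma slot_mult: "slot (S \<otimes>\<^bsub>Spin8\<^esub> T) i = slot S i ** slot T i"
  by (cases S; cases T) (simp add: slot_def Spin8_def tilde_mult)

lemma slot_one: "slot \<one>\<^bsub>Spin8\<^esub> i = mat 1"
  by (simp add: slot_def Spin8_def)

lemma of_slots_mem_Spin8_iff:
  "of_slots X \<in> carrier Spin8 \<longleftrightarrow> (\<forall>i\<in>{1..3}. rotation_matrix (X i)) \<and>
     (\<forall>x. octform (\<lambda>i. X i *v x i) = octform x)"
proof -
  have "octform (\<lambda>i. slot (of_slots X) i *v x i) = octform (\<lambda>i. X i *v x i)" for x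
    by (rule octform_cong) (simp add: slot_of_slots)
  then show ?thesis
    by (simp add: mem_Spin8_iff slot_of_slots)
qed

lemma group_Spin8: "group Spin8"
proof (rule groupI)
  fix S T assume "S \<in> carrier Spin8" "T \<in> carrier Spin8"
  then show "S \<otimes>\<^bsub>Spin8\<^esub> T \<in> carrier Spin8"
    by (simp add: mem_Spin8_iff slot_mult rotation_matrix_def orthogonal_matrix_mul det_mul
        flip: matrix_vector_mul_assoc)
next
  show "\<one>\<^bsub>Spin8\<^esub> \<in> carrier Spin8"
    by (simp add: mem_Spin8_iff slot_one rotation_matrix_def orthogonal_matrix_id)
next
  fix S T U
  show "S \<otimes>\<^bsub>Spin8\<^esub> T \<otimes>\<^bsub>Spin8\<^esub> U = S \<otimes>\<^bsub>Spin8\<^esub> (T \<otimes>\<^bsub>Spin8\<^esub> U)"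
    by (simp add: triple_eq_iff_slots slot_mult matrix_mul_assoc)
next
  fix T
  show "\<one>\<^bsub>Spin8\<^esub> \<otimes>\<^bsub>Spin8\<^esub> T = T"
    by (simp add: triple_eq_iff_slots slot_mult slot_one)
next
  fix T assume T: "T \<in> carrier Spin8"
  define X where "X = (\<lambda>i. transpose (slot T i))"
  have inv: "X i ** slot T i = mat 1" "slot T i ** X i = mat 1" if "i \<in> {1..3}" for i
    using T that by (simp_all add: X_def mem_Spin8_iff rotation_matrix_def orthogonal_matrix_def)
  have "octform (\<lambda>i. X i *v x i) = octform x" for x
  proof -
    have "octform (\<lambda>i. X i *v x i) = octform (\<lambda>i. slot T i *v (X i *v x i))"
      using T by (simp add: mem_Spin8_iff)
    also have "\<dots> = octform x"
      by (rule octform_cong) (simp add: inv matrix_vector_mul_assoc)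
    finally show ?thesis .
  qed
  moreover have "rotation_matrix (X i)" if "i \<in> {1..3}" for i
    using T that by (simp add: X_def mem_Spin8_iff rotation_matrix_def)
  ultimately have "of_slots X \<in> carrier Spin8"
    by (simp add: of_slots_mem_Spin8_iff)
  moreover have "of_slots X \<otimes>\<^bsub>Spin8\<^esub> T = \<one>\<^bsub>Spin8\<^esub>"
    by (simp add: triple_eq_iff_slots slot_mult slot_one slot_of_slots inv)
  ultimately show "\<exists>S\<in>carrier Spin8. S \<otimes>\<^bsub>Spin8\<^esub> T = \<one>\<^bsub>Spin8\<^esub>"
    by blast
qed

section \<open>The action of the symmetric group\<close>

definition twist :: "(nat \<Rightarrow> nat) \<Rightarrow> real^8^8 \<Rightarrow> real^8^8" where
  "twist p D = (if evenperm p then D else tilde D)"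

text \<open>
  The inverse of \<open>p\<close> makes this a left action: the entry in slot \<open>i\<close> is moved to slot \<open>p i\<close>.
\<close>

definition triality :: "(nat \<Rightarrow> nat) \<Rightarrow> triple \<Rightarrow> triple" where
  "triality p = restrict (\<lambda>T. of_slots (\<lambda>i. twist p (slot T (inv' p i)))) (carrier Spin8)"

lemma slot_triality:
  "T \<in> carrier Spin8 \<Longrightarrow> i \<in> {1..3} \<Longrightarrow> slot (triality p T) i = twist p (slot T (inv' p i))"
  by (simp add: triality_def slot_of_slots)

text \<open>
  Moving the entries of \<open>X\<close> by \<open>p\<close> amounts to permuting (and, for odd \<open>p\<close>, conjugating) the vectors
  that they act on and undoing this afterwards. Both changes preserve the form by
  \<open>octform_permute\<close>, and so does \<open>X\<close>.
\<close>

lemma triality_closed: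
  assumes p: "p permutes {1..3}" and T: "T \<in> carrier Spin8"
  shows "triality p T \<in> carrier Spin8"
proof -
  define q where "q = inv' p"
  have q: "q permutes {1..3}" and pq: "p (q i) = i" and ev: "evenperm q = evenperm p" for i
    using p by (simp_all add: q_def permutes_inv permutes_inverses[OF p] evenperm_inv
        permutes_imp_permutation[of "{1..3}"])
  have "octform (\<lambda>i. twist p (slot T (q i)) *v x i) = octform x" for x
  proof -
    \<comment> \<open>Both parities at once: an involution of the octonions which \<^const>\<open>twist\<close> conjugates with.\<close>
    define c where "c = (\<lambda>v. if evenperm p then v else oct_cnj v)"
    have tw: "twist p D *v v = c (D *v c v)" and cc: "c (c v) = v" for D v
      by (simp_all add: twist_def c_def tilde_apply)
    have perm: "octform (\<lambda>i. c (y (q i))) = octform y" for y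
      using octform_permute[OF q, of y] by (simp add: c_def ev if_distrib)
    have "octform (\<lambda>i. twist p (slot T (q i)) *v x i)
        = octform (\<lambda>i. c (slot T (q i) *v c (x (p (q i)))))"
      by (simp add: tw pq)
    also have "\<dots> = octform (\<lambda>j. slot T j *v c (x (p j)))"
      by (rule perm)
    also have "\<dots> = octform (\<lambda>j. c (x (p j)))"
      using T by (simp add: mem_Spin8_iff)
    also have "\<dots> = octform (\<lambda>i. c (c (x (p (q i)))))"
      by (rule perm[symmetric])
    also have "\<dots> = octform x"
      by (simp add: cc pq)
    finally show ?thesis .
  qed
  moreover have "rotation_matrix (twist p (slot T (q i)))" if "i \<in> {1..3}" for i
    using T that permutes_in_image[OF q, of i] by (simp add: mem_Spin8_iff twist_def)
  ultimately show ?thesis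
    using T by (simp add: triality_def of_slots_mem_Spin8_iff flip: q_def)
qed

lemma twist_comp:
  assumes "p permutes {1..3}" "q permutes {1..3}"
  shows "twist (p \<circ> q) D = twist p (twist q D)"
  using assms by (simp add: twist_def evenperm_comp permutes_imp_permutation[of "{1..3}"])

lemma triality_comp:
  assumes p: "p permutes {1..3}" and q: "q permutes {1..3}"
  shows "triality (p \<circ> q) = compose (carrier Spin8) (triality p) (triality q)"
proof (rule extensionalityI[of _ "carrier Spin8"])
  fix T assume T: "T \<in> carrier Spin8"
  have "inv' (p \<circ> q) i = inv' q (inv' p i)" for i
    using p q by (simp add: o_inv_distrib permutes_bij)
  moreover have "inv' p i \<in> {1..3}" if "i \<in> {1..3}" for i
    using permutes_in_image[OF permutes_inv[OF p], of i] that by blast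
  ultimately show "triality (p \<circ> q) T = compose (carrier Spin8) (triality p) (triality q) T"
    using T assms by (simp add: compose_eq triple_eq_iff_slots slot_triality triality_closed
        twist_comp)
qed (simp_all add: triality_def)

lemma triality_id: "triality id = (\<lambda>T\<in>carrier Spin8. T)"
proof (rule extensionalityI[of _ "carrier Spin8"])
  show "triality id T = (\<lambda>T\<in>carrier Spin8. T) T" if "T \<in> carrier Spin8" for T
    using that by (simp add: triple_eq_iff_slots slot_triality twist_def)
qed (simp_all add: triality_def)

lemma triality_auto:
  assumes p: "p permutes {1..3}"
  shows "triality p \<in> auto Spin8"
proof -
  have cancel: "triality r (triality q T) = T"
    if "T \<in> carrier Spin8" "r permutes {1..3}" "q permutes {1..3}" "r \<circ> q = id" for r q T
  proof -
    have "triality r (triality q T) = triality (r \<circ> q) T"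
      using that(1) by (simp only: triality_comp[OF that(2,3)] compose_eq)
    then show ?thesis
      using that by (simp add: triality_id)
  qed
  have "bij_betw (triality p) (carrier Spin8) (carrier Spin8)"
  proof (rule bij_betw_byWitness[where f' = "triality (inv' p)"])
    note q = permutes_inv[OF p]
    show "\<forall>T\<in>carrier Spin8. triality (inv' p) (triality p T) = T"
      using cancel[OF _ q p permutes_inv_o(2)[OF p]] by blast
    show "\<forall>T\<in>carrier Spin8. triality p (triality (inv' p) T) = T"
      using cancel[OF _ p q permutes_inv_o(1)[OF p]] by blast
    show "triality p ` carrier Spin8 \<subseteq> carrier Spin8"
      using triality_closed[OF p] by blast
    show "triality (inv' p) ` carrier Spin8 \<subseteq> carrier Spin8"
      using triality_closed[OF q] by blast
  qed
  moreover have "triality p \<in> hom Spin8 Spin8"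
  proof (rule homI)
    fix S T assume "S \<in> carrier Spin8" "T \<in> carrier Spin8"
    then show "triality p (S \<otimes>\<^bsub>Spin8\<^esub> T) = triality p S \<otimes>\<^bsub>Spin8\<^esub> triality p T"
      using p by (simp add: triple_eq_iff_slots slot_triality slot_mult twist_def tilde_mult
          monoid.m_closed[OF group.is_monoid[OF group_Spin8]])
  qed (rule triality_closed[OF p])
  ultimately show ?thesis
    by (simp add: auto_def Bij_def triality_def)
qed

lemma mult_AutoGroup:
  "f \<in> auto G \<Longrightarrow> g \<in> auto G \<Longrightarrow> f \<otimes>\<^bsub>AutoGroup G\<^esub> g = compose (carrier G) f g"
  by (simp add: AutoGroup_def BijGroup_def auto_def)

lemma carrier_AutoGroup: "carrier (AutoGroup G) = auto G"
  by (simp add: AutoGroup_def)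

lemma triality_hom: "triality \<in> hom (sym_group 3) (AutoGroup Spin8)"
  by (intro homI) (simp_all add: sym_group_def carrier_AutoGroup triality_auto triality_comp
      mult_AutoGroup)

section \<open>Faithfulness\<close>

text \<open>The three nontrivial elements of the centre, one for each slot.\<close>

definition sign_triple :: "nat \<Rightarrow> triple" where
  "sign_triple k = of_slots (\<lambda>i. if i = k then mat 1 else - mat 1)"

lemma sign_triple_mem_Spin8:
  assumes "k \<in> {1..3}"
  shows "sign_triple k \<in> carrier Spin8"
proof -
  have neg: "(- u) \<odot> v = - (u \<odot> v)" "u \<odot> (- v) = - (u \<odot> v)" "oct_cnj (- u) = - oct_cnj u"
    for u v
    by (simp_all add: vec_eq_iff forall_8 oct_unfold)
  have sgn: "(if P then mat 1 else - mat 1 :: real^8^8) *v v = (if P then v else - v)" for P v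
    by (simp add: minus_one_apply)
  have "octform (\<lambda>i. if i = k then x i else - x i) = octform x" for x
    using assms unfolding atLeastAtMost_1_3 octform_def by (elim insertE) (simp_all add: neg)
  moreover have "rotation_matrix (mat 1 :: real^8^8)"
    by (simp add: rotation_matrix_def orthogonal_matrix_id)
  ultimately show ?thesis
    by (simp add: sign_triple_def of_slots_mem_Spin8_iff rotation_minus_one sgn)
qed

lemma triality_sign_triple:
  assumes p: "p permutes {1..3}" and k: "k \<in> {1..3}"
  shows "triality p (sign_triple k) = sign_triple (p k)"
proof -
  have "inv' p i = k \<longleftrightarrow> i = p k" for i
    using permutes_inv_eq[OF p, of i k] by auto
  moreover have "inv' p i \<in> {1..3}" if "i \<in> {1..3}" for i
    using permutes_in_image[OF permutes_inv[OF p], of i] that by blast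
  ultimately have "slot (triality p (sign_triple k)) i = slot (sign_triple (p k)) i"
    if "i \<in> {1..3}" for i
    using k that sign_triple_mem_Spin8[OF k]
    by (simp add: slot_triality) (simp add: sign_triple_def slot_of_slots twist_def tilde_minus)
  then show ?thesis
    by (simp add: triple_eq_iff_slots)
qed

lemma sign_triple_inj: "inj_on sign_triple {1..3}"
proof
  fix j k :: nat assume j: "j \<in> {1..3}" and eq: "sign_triple j = sign_triple k"
  have slot: "slot (sign_triple k) j = (if j = k then mat 1 else - mat 1)" for k
    using slot_of_slots[OF j] by (simp add: sign_triple_def)
  have "(- mat 1 :: real^8^8) $ 1 $ 1 \<noteq> mat 1 $ 1 $ 1"
    by (simp add: mat_def)
  then have "(- mat 1 :: real^8^8) \<noteq> mat 1"
    by metis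
  moreover have "slot (sign_triple k) j = mat 1"
    using slot[of j] by (simp add: eq)
  ultimately show "j = k"
    by (simp add: slot split: if_splits)
qed

lemma triality_inj: "inj_on triality (carrier (sym_group 3))"
proof
  fix p q assume "p \<in> carrier (sym_group 3)" "q \<in> carrier (sym_group 3)"
    and eq: "triality p = triality q"
  then have p: "p permutes {1..3}" and q: "q permutes {1..3}"
    by (simp_all add: sym_group_carrier)
  show "p = q"
  proof
    fix k
    show "p k = q k"
    proof (cases "k \<in> {1..3}")
      case True
      then have "sign_triple (p k) = sign_triple (q k)"
        by (metis eq p q triality_sign_triple)
      then show ?thesis
        using True permutes_in_image[OF p] permutes_in_image[OF q]
        by (meson inj_onD sign_triple_inj)
    next
      case False
      then show ?thesis
        using p q by (simp add: permutes_not_in)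
    qed
  qed
qed

section \<open>The generators\<close>

text \<open>
  The cycle \<open>1 \<mapsto> 3 \<mapsto> 2 \<mapsto> 1\<close>, so that slot \<open>i\<close> of a triple moved by it holds the former entry of
  slot \<open>i + 1\<close> (cyclically).
\<close>

definition rotate3 :: "nat \<Rightarrow> nat" where
  "rotate3 = transposition 2 3 \<circ> transposition 1 2"

lemma rotate3_permutes: "rotate3 permutes {1..3}"
  unfolding rotate3_def by (intro permutes_compose permutes_swap_id) auto

lemma spin_sigma_eq_triality: "spin_sigma = triality (transposition 2 3)"
proof (rule extensionalityI[of _ "carrier Spin8"])
  fix T assume "T \<in> carrier Spin8"
  then show "spin_sigma T = triality (transposition 2 3) T"
    by (cases T) (simp add: spin_sigma_def triality_def of_slots_def slot_def twist_def
        evenperm_swap)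
qed (simp_all add: spin_sigma_def triality_def)

lemma spin_tau_eq_triality: "spin_tau = triality rotate3"
proof (rule extensionalityI[of _ "carrier Spin8"])
  have "inv' rotate3 = transposition 1 2 \<circ> transposition 2 3"
    unfolding rotate3_def by (simp add: o_inv_distrib)
  moreover have "evenperm rotate3"
    by (simp add: rotate3_def evenperm_comp permutation_swap_id evenperm_swap)
  moreover fix T assume "T \<in> carrier Spin8"
  ultimately show "spin_tau T = triality rotate3 T"
    by (cases T) (simp add: spin_tau_def triality_def of_slots_def slot_def twist_def
        Transposition.transpose_def)
qed (simp_all add: spin_tau_def triality_def)

text \<open>
  Transpositions generate, and the two missing ones are the products of the given transposition with the
  cycle in either order.
\<close>

lemma sym_group_3_generated:
  "generate (sym_group 3) {transposition 2 3, rotate3} = carrier (sym_group 3)" (is "?H = _")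
proof
  interpret group "sym_group 3"
    by (rule sym_group_is_group)
  have "transposition 2 3 permutes {1..3::nat}"
    by (intro permutes_swap_id) auto
  then show "?H \<subseteq> carrier (sym_group 3)"
    by (intro generate_incl) (simp add: sym_group_carrier rotate3_permutes)
  have comp: "p \<circ> q \<in> ?H" if "p \<in> ?H" "q \<in> ?H" for p q
    using generate.eng[OF that] by (simp add: sym_group_mult)
  have s: "transposition 2 3 \<in> ?H" and r: "rotate3 \<in> ?H"
    by (simp_all add: generate.incl)
  have "transposition 1 2 = transposition 2 3 \<circ> rotate3"
    "transposition 1 3 = rotate3 \<circ> transposition 2 3"
    by (auto simp: rotate3_def fun_eq_iff Transposition.transpose_def)
  then have "transposition 1 2 \<in> ?H" "transposition 1 3 \<in> ?H"
    using comp s r by metis+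
  with s have swaps: "transposition a b \<in> ?H" if "a \<in> {1..3}" "b \<in> {1..3}" "a \<noteq> b" for a b
    using that by (auto simp: atLeastAtMost_1_3 Transposition.transpose_commute)
  show "carrier (sym_group 3) \<subseteq> ?H"
  proof
    fix p assume "p \<in> carrier (sym_group 3)"
    then have "p permutes {1..3}"
      by (simp add: sym_group_carrier)
    then show "p \<in> ?H"
      using finite_atLeastAtMost
    proof (induction rule: permutes_induct)
      case id
      show ?case
        using generate.one[of "sym_group 3"] unfolding sym_group_one .
    next
      case (swap a b p)
      then show ?case
        by (intro comp swaps)
    qed
  qed
qed

theorem lemma3p4:
  shows "group Spin8
    \<and> spin_sigma \<in> auto Spin8
    \<and> spin_tau \<in> auto Spin8
    \<and> subgroup Gamma_hat (AutoGroup Spin8)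
    \<and> (AutoGroup Spin8)\<lparr>carrier := Gamma_hat\<rparr> \<cong> sym_group 3"
proof -
  have group_Aut: "group (AutoGroup Spin8)"
    by (rule group.AutoGroup[OF group_Spin8])
  then interpret triality: group_hom "sym_group 3" "AutoGroup Spin8" triality
    by (intro group_hom.intro group_hom_axioms.intro sym_group_is_group triality_hom)
  have swap: "transposition 2 3 permutes {1..3::nat}"
    by (intro permutes_swap_id) auto
  have sigma: "spin_sigma \<in> auto Spin8" and tau: "spin_tau \<in> auto Spin8"
    by (simp_all add: spin_sigma_eq_triality spin_tau_eq_triality triality_auto swap
        rotate3_permutes)
  have sub: "subgroup Gamma_hat (AutoGroup Spin8)"
    unfolding Gamma_hat_def
    by (rule group.generate_is_subgroup[OF group_Aut]) (simp add: carrier_AutoGroup sigma tau)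
  have "triality ` carrier (sym_group 3) = Gamma_hat"
    using triality.generate_img[of "{transposition 2 3, rotate3}"] swap rotate3_permutes
    by (simp add: sym_group_3_generated Gamma_hat_def spin_sigma_eq_triality
        spin_tau_eq_triality sym_group_carrier)
  then have "triality \<in> iso (sym_group 3) ((AutoGroup Spin8)\<lparr>carrier := Gamma_hat\<rparr>)"
    using triality_hom triality_inj by (auto simp: iso_def hom_def bij_betw_def)
  then have "(AutoGroup Spin8)\<lparr>carrier := Gamma_hat\<rparr> \<cong> sym_group 3"
    using group.iso_sym[OF sym_group_is_group] is_isoI by blast
  with group_Spin8 sigma tau sub show ?thesis
    by blast
qed

end
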